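(* For $n\geq1$, $$\sum_{\pi\in RS_n}t^{\mathrm{asc}(\pi)}u^{\pi_n}=\sum_{e\in\mathbf{I}_n(000)}t^{\mathrm{dist}(e)}u^{e_n+1}.$$
   Context: A permutation $\pi$ of $\{1,\ldots,n\}$ is a Simsun permutation if for every $k\in\{1,\ldots,n\}$ the word obtained from $\pi$ by deleting the values $k+1,\ldots,n$ has no double descent, i.e. no three consecutive letters $w_{i-1}>w_i>w_{i+1}$; $RS_n$ is the set of Simsun permutations of $\{1,\ldots,n\}$. $\mathrm{asc}(\pi)=n-1-\mathrm{des}(\pi)$, where $\mathrm{des}(\pi)$ is the number of $i\in[n-1]$ with $\pi_i>\pi_{i+1}$. $\mathbf{I}_n=\{(e_1,\ldots,e_n): 0\leq e_i<i\}$; $\mathbf{I}_n(000)$ is the set of $e\in\mathbf{I}_n$ with no $i<j<k$ such that $e_i=e_j=e_k$. $\mathrm{dist}(e)$ is the number of distinct positive values among the entries of $e$. *)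

theory Defs
  imports "HOL-Combinatorics.Multiset_Permutations"
begin

text \<open>
  Permutations of $\{1,\dots,n\}$ and inversion sequences are lists in one-line notation. List
  positions start at 0, so the letter $\pi_i$ is \<open>p ! (i - 1)\<close> and the last letter
  $\pi_n$ is \<open>last p\<close>.
\<close>

definition no_double_descent :: "nat list \<Rightarrow> bool" where
  "no_double_descent w \<longleftrightarrow>
     \<not> (\<exists>i. i + 2 < length w \<and> w ! i > w ! (i + 1) \<and> w ! (i + 1) > w ! (i + 2))"

definition simsun :: "nat \<Rightarrow> nat list set" where
  "simsun n = {p \<in> permutations_of_set {1..n}.
     \<forall>k\<in>{1..n}. no_double_descent (filter (\<lambda>x. x \<notin> {k+1..n}) p)}"

definition des :: "nat list \<Rightarrow> nat" where
  "des p = card {i. i + 1 < length p \<and> p ! i > p ! (i + 1)}"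

definition asc :: "nat list \<Rightarrow> nat" where
  "asc p = length p - 1 - des p"

text \<open>The condition $e_i < i$ for $1 \le i \le n$ becomes \<open>e ! i < i + 1\<close> for
  \<open>i < n\<close>.\<close>

definition inv_seqs :: "nat \<Rightarrow> nat list set" where
  "inv_seqs n = {e. length e = n \<and> (\<forall>i<n. e ! i < i + 1)}"

definition inv_seqs_000 :: "nat \<Rightarrow> nat list set" where
  "inv_seqs_000 n = {e \<in> inv_seqs n.
     \<not> (\<exists>i j k. i < j \<and> j < k \<and> k < n \<and> e ! i = e ! j \<and> e ! j = e ! k)}"

definition dist_pos :: "nat list \<Rightarrow> nat" where
  "dist_pos e = card {v \<in> set e. v > 0}"

lemma finite_simsun: "finite (simsun n)"
  by (simp add: simsun_def)

lemma finite_inv_seqs: "finite (inv_seqs n)"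
proof (rule finite_subset)
  show "inv_seqs n \<subseteq> {e. set e \<subseteq> {..<n} \<and> length e = n}"
    by (fastforce simp: inv_seqs_def in_set_conv_nth less_Suc_eq_le)
  show "finite {e. set e \<subseteq> {..<n} \<and> length e = n}"
    by (rule finite_lists_length_eq) simp
qed

lemma finite_inv_seqs_000: "finite (inv_seqs_000 n)"
  using finite_inv_seqs by (simp add: inv_seqs_000_def)

end

theory Submission
  imports Defs
begin

text \<open>
  Both sides obey the same recursion. A Simsun permutation \<open>p\<close> of size \<open>n\<close> with \<open>d\<close> descents
  extends to size \<open>n + 1\<close> by inserting \<open>n + 1\<close> anywhere except just before a descent top.
  Inserting at the end creates an ascent and changes the last letter to \<open>n + 1\<close>; the other
  insertions keep the last letter: the \<open>d\<close> of them inside a descent create an ascent and the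
  remaining \<open>n - 2 d\<close> create a descent.

  An inversion sequence of length \<open>n + 1\<close> ending in \<open>n\<close> arises by appending \<open>n\<close> to an arbitrary one of
  length \<open>n\<close>. One ending in a smaller entry arises from a unique one of length \<open>n\<close> by inserting, just
  before the last entry, some \<open>w < n\<close> that occurs at most once. If there are \<open>k\<close> distinct positive
  entries, then \<open>n - 1 - k\<close> of these \<open>w\<close> are new and, since entries occur at most twice,
  \<open>2 (k + 1) - n\<close> of them occur exactly once. With \<open>k = asc = n - 1 - d\<close> these numbers are \<open>d\<close>
  and \<open>n - 2 d\<close>.
\<close>

text \<open>\<open>F\<close> weighs an object by its statistic and its last letter; the value is the
  total weight of all extensions of an object of size \<open>n\<close> with data \<open>a\<close>
  and \<open>l\<close>. On actual objects the natural subtractions are cardinalities, so nothing is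
  truncated.\<close>

definition grow :: "nat \<Rightarrow> (nat \<Rightarrow> nat \<Rightarrow> 'a::semiring_1) \<Rightarrow> nat \<Rightarrow> nat \<Rightarrow> 'a" where
  "grow n F a l = F (Suc a) (Suc n) + of_nat (n - 1 - a) * F (Suc a) l
     + of_nat (2 * a + 2 - n) * F a l"

section \<open>Simsun permutations\<close>

definition descents :: "nat list \<Rightarrow> nat set" where
  "descents p = {i. i + 1 < length p \<and> p ! i > p ! (i + 1)}"

lemma des_eq_card_descents: "des p = card (descents p)"
  by (simp add: des_def descents_def)

lemma finite_descents [simp]: "finite (descents p)"
  by (rule finite_subset[of _ "{..<length p}"]) (auto simp: descents_def)

lemma no_double_descent_iff_descents:
  "no_double_descent p \<longleftrightarrow> descents p \<inter> Suc ` descents p = {}"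
  by (auto simp: no_double_descent_def descents_def)

section \<open>Descents under insertion of a new maximum\<close>

definition insert_at :: "nat \<Rightarrow> 'a \<Rightarrow> 'a list \<Rightarrow> 'a list" where
  "insert_at i x p = take i p @ x # drop i p"

lemma length_insert_at [simp]: "length (insert_at i x p) = Suc (length p)"
  by (simp add: insert_at_def)

lemma set_insert_at [simp]: "set (insert_at i x p) = insert x (set p)"
  by (metis Un_insert_right append_take_drop_id insert_at_def list.simps(15) set_append)

lemma distinct_insert_at [simp]: "distinct (insert_at i x p) \<longleftrightarrow> distinct p \<and> x \<notin> set p"
proof -
  have "distinct (insert_at i x p) \<longleftrightarrow> distinct (take i p @ drop i p) \<and> x \<notin> set (take i p @ drop i p)"
    unfolding insert_at_def distinct_append set_append by auto
  then show ?thesis by simp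
qed

lemma nth_insert_at:
  assumes "i \<le> length p"
  shows "insert_at i x p ! j = (if j < i then p ! j else if j = i then x else p ! (j - 1))"
  using assms by (auto simp: insert_at_def nth_append nth_Cons min_def split: nat.split
      intro!: arg_cong[of _ _ "(!) p"])

lemma last_insert_at:
  assumes "i \<le> length p"
  shows "last (insert_at i x p) = (if i = length p then x else last p)"
  using assms by (auto simp: insert_at_def)

lemma filter_insert_at:
  "filter P (insert_at i x p) = (if P x then insert_at (length (filter P (take i p))) x (filter P p) else filter P p)"
proof -
  have "filter P p = filter P (take i p) @ filter P (drop i p)"
    by (metis append_take_drop_id filter_append)
  then show ?thesis by (simp add: insert_at_def)
qed

text \<open>Recovers the slot of a fresh letter, which makes insertion invertible.\<close>

lemma length_takeWhile_insert_at:
  assumes "i \<le> length p" "x \<notin> set p"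
  shows "length (takeWhile (\<lambda>y. y \<noteq> x) (insert_at i x p)) = i"
proof -
  have "\<forall>y\<in>set (take i p). y \<noteq> x" using assms(2) by (metis in_set_takeD)
  then show ?thesis using assms(1) by (simp add: insert_at_def takeWhile_append2)
qed

text \<open>A new maximum is entered by an ascent and left by a descent: a descent across the slot
  disappears, later descents shift by one, and \<open>i\<close> becomes a descent unless the slot is
  the end. Writing \<open>{j. Suc j = i}\<close> covers \<open>i = 0\<close>, where nothing is
  removed.\<close>

lemma descents_insert_max:
  assumes "i \<le> length p" "\<forall>y\<in>set p. y < m"
  shows "descents (insert_at i m p) =
    (\<lambda>j. if j < i then j else Suc j) ` (descents p - {j. Suc j = i}) \<union> (if i < length p then {i} else {})"
    (is "?L = ?R")
proof (rule set_eqI)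
  fix j
  have less: "p ! k < m" if "k < length p" for k using assms(2) that by auto
  \<comment> \<open>The pair at positions \<open>j\<close> and \<open>Suc j\<close> lies before the
    new letter, ends at it, starts at it, or lies after it.\<close>
  consider "Suc j < i" | "Suc j = i" | "j = i" | k where "j = Suc k" "i \<le> k"
    by (metis Suc_lessI le_eq_less_or_eq less_Suc_eq_le linorder_neqE_nat not0_implies_Suc not_less_zero)
  then show "j \<in> ?L \<longleftrightarrow> j \<in> ?R"
  proof cases
    case 1
    then show ?thesis using assms(1)
      by (auto simp: descents_def nth_insert_at image_iff)
  next
    case 2
    then show ?thesis using assms(1) less[of j]
      by (auto simp: descents_def nth_insert_at image_iff)
  next
    case 3
    then show ?thesis using assms(1) less[of j]
      by (auto simp: descents_def nth_insert_at image_iff)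
  next
    case 4
    then show ?thesis using assms(1)
      by (auto simp: descents_def nth_insert_at image_iff)
  qed
qed

lemma des_insert_max:
  assumes "i \<le> length p" "\<forall>y\<in>set p. y < m"
  shows "des (insert_at i m p) =
    (if i = length p then des p else if i \<in> Suc ` descents p then des p else Suc (des p))"
proof -
  let ?s = "\<lambda>j. if j < i then j else Suc j" and ?D = "descents p - {j. Suc j = i}"
  have "inj_on ?s ?D" by (auto simp: inj_on_def split: if_splits)
  then have "card (?s ` ?D) = card ?D" by (rule card_image)
  moreover have "i \<notin> ?s ` ?D" by auto
  ultimately have c: "des (insert_at i m p) = card ?D + (if i < length p then 1 else 0)"
    unfolding des_eq_card_descents descents_insert_max[OF assms]
    by (simp del: if_image_distrib)
  show ?thesis
  proof (cases "i \<in> Suc ` descents p")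
    case True
    then obtain j where j: "i = Suc j" "j \<in> descents p" by auto
    then have "{j. Suc j = i} = {j}" "i < length p" by (auto simp: descents_def)
    \<comment> \<open>Positivity matters: the count drops by one under natural subtraction before it
      rises by one.\<close>
    moreover have "card (descents p) > 0" using j by (auto simp: card_gt_0_iff)
    ultimately show ?thesis using c j True by (simp add: des_eq_card_descents)
  next
    case False
    then have "?D = descents p" by auto
    then show ?thesis using c False assms(1) by (auto simp: des_eq_card_descents)
  qed
qed

text \<open>Since the step into the maximum is an ascent, a new double descent could only start at
  the maximum, followed by the two letters of a descent of \<open>p\<close> at
  \<open>i\<close>.\<close>

lemma no_double_descent_insert_max:
  assumes "i \<le> length p" "\<forall>y\<in>set p. y < m" "no_double_descent p"
  shows "no_double_descent (insert_at i m p) \<longleftrightarrow> i \<notin> descents p"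
proof
  assume L: "no_double_descent (insert_at i m p)"
  show "i \<notin> descents p"
  proof
    assume i: "i \<in> descents p"
    then have "i < length p" by (simp add: descents_def)
    with i have "i \<in> descents (insert_at i m p)" "Suc i \<in> descents (insert_at i m p)"
      unfolding descents_insert_max[OF assms(1,2)] by auto
    with L show False unfolding no_double_descent_iff_descents by auto
  qed
next
  assume "i \<notin> descents p"
  then show "no_double_descent (insert_at i m p)"
    using assms(3) unfolding no_double_descent_iff_descents descents_insert_max[OF assms(1,2)]
    by (auto split: if_splits)
qed

section \<open>Simsun permutations built by inserting the largest letter\<close>

lemma simsun_Suc_iff:
  assumes "q \<in> permutations_of_set {1..Suc n}"
  shows "q \<in> simsun (Suc n) \<longleftrightarrow> no_double_descent q \<and> filter (\<lambda>y. y \<noteq> Suc n) q \<in> simsun n"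
proof -
  let ?p = "filter (\<lambda>y. y \<noteq> Suc n) q"
  have q: "set q = {1..Suc n}" "distinct q" using assms by (auto simp: permutations_of_set_def)
  then have p: "?p \<in> permutations_of_set {1..n}" by (auto simp: permutations_of_set_def)
  \<comment> \<open>For \<open>k\<close> up to \<open>n\<close> the restriction of \<open>q\<close>
    discards \<open>Suc n\<close> anyway, so it is a restriction of \<open>?p\<close>; only
    \<open>k = Suc n\<close> tests \<open>q\<close> itself.\<close>
  have "filter (\<lambda>x. x \<notin> {k+1..Suc n}) q = filter (\<lambda>x. x \<notin> {k+1..n}) ?p" if "k \<in> {1..n}" for k
    using that by (auto intro!: filter_cong)
  moreover have "filter (\<lambda>x. x \<notin> {Suc n+1..Suc n}) q = q" by simp
  moreover have "{1..Suc n} = insert (Suc n) {1..n}" by auto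
  ultimately show ?thesis using assms p by (simp add: simsun_def del: atLeastAtMost_iff)
qed

lemma simsun_no_double_descent:
  assumes "p \<in> simsun n"
  shows "no_double_descent p"
proof (cases "n = 0")
  case True
  then show ?thesis using assms by (simp add: simsun_def no_double_descent_def)
next
  case False
  then have "no_double_descent (filter (\<lambda>x. x \<notin> {n+1..n}) p)"
    using assms unfolding simsun_def by fastforce
  then show ?thesis by simp
qed

lemma insert_at_in_simsun_iff:
  assumes "p \<in> permutations_of_set {1..n}" "i \<le> n"
  shows "insert_at i (Suc n) p \<in> simsun (Suc n) \<longleftrightarrow> p \<in> simsun n \<and> i \<notin> descents p"
proof -
  have p: "set p = {1..n}" "distinct p" "length p = n"
    using assms(1) by (auto simp: permutations_of_set_def distinct_card[symmetric])
  have perm: "insert_at i (Suc n) p \<in> permutations_of_set {1..Suc n}"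
    using p by (auto simp: permutations_of_set_def)
  have filter: "filter (\<lambda>y. y \<noteq> Suc n) (insert_at i (Suc n) p) = p"
    using p by (auto simp: filter_insert_at intro!: filter_True)
  have "p \<in> simsun n \<Longrightarrow> no_double_descent (insert_at i (Suc n) p) \<longleftrightarrow> i \<notin> descents p"
    using no_double_descent_insert_max[of i p "Suc n"] simsun_no_double_descent[of p n] p assms(2) by auto
  then show ?thesis unfolding simsun_Suc_iff[OF perm] filter by blast
qed

lemma simsunD:
  assumes "p \<in> simsun n"
  shows "p \<in> permutations_of_set {1..n}" "set p = {1..n}" "distinct p" "length p = n"
proof -
  show p: "p \<in> permutations_of_set {1..n}" using assms by (simp add: simsun_def)
  then show "set p = {1..n}" "distinct p" by (simp_all add: permutations_of_set_def)
  show "length p = n" using length_finite_permutations_of_set[OF p] by simp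
qed

text \<open>Deleting \<open>Suc n\<close> while recording its slot inverts the insertion; of the
  slots \<open>{..n}\<close>, exactly those in \<open>descents p\<close> are forbidden.\<close>

lemma sum_simsun_Suc_eq_sum_insert_at:
  "(\<Sum>q\<in>simsun (Suc n). f q) =
   (\<Sum>p\<in>simsun n. \<Sum>i\<in>{..n} - descents p. f (insert_at i (Suc n) p))"
proof -
  let ?p = "filter (\<lambda>y. y \<noteq> Suc n)" and ?i = "\<lambda>q. length (takeWhile (\<lambda>y. y \<noteq> Suc n) q)"
  have split: "?i q \<le> n \<and> insert_at (?i q) (Suc n) (?p q) = q" if "q \<in> simsun (Suc n)" for q
  proof -
    have "Suc n \<in> set q" "distinct q" and len: "length q = Suc n" using simsunD[OF that] by auto
    then obtain xs ys where q: "q = xs @ Suc n # ys" "Suc n \<notin> set xs" "Suc n \<notin> set ys"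
      by (metis distinct.simps(2) distinct_append in_set_conv_decomp_first)
    then have "?p xs = xs" "?p ys = ys" by (auto simp: filter_id_conv)
    with q have "?p q = xs @ ys" "?i q = length xs" 
      by (auto simp: takeWhile_append)
    then show ?thesis using q len by (simp add: insert_at_def)
  qed
  have "(\<Sum>q\<in>simsun (Suc n). f q) =
      (\<Sum>(p, i)\<in>(SIGMA p:simsun n. {..n} - descents p). f (insert_at i (Suc n) p))"
  proof (rule sum.reindex_bij_witness[where
        i = "\<lambda>(p, i). insert_at i (Suc n) p" and j = "\<lambda>q. (?p q, ?i q)"])
    fix q assume q: "q \<in> simsun (Suc n)"
    note s = split[OF q]
    have "?p q \<in> simsun n" using q simsun_Suc_iff[OF simsunD(1)[OF q]] by simp
    \<comment> \<open>Reinserting gives back \<open>q\<close>, which is Simsun, so its slot was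
      admissible.\<close>
    moreover from this have "?i q \<notin> descents (?p q)"
      using insert_at_in_simsun_iff[of "?p q" n "?i q"] simsunD(1)[of "?p q" n] s q by simp
    ultimately show "(?p q, ?i q) \<in> (SIGMA p:simsun n. {..n} - descents p)" using s by simp
    show "(case (?p q, ?i q) of (p, i) \<Rightarrow> insert_at i (Suc n) p) = q" using s by simp
    show "(case (?p q, ?i q) of (p, i) \<Rightarrow> f (insert_at i (Suc n) p)) = f q" using s by simp
  next
    fix x assume "x \<in> (SIGMA p:simsun n. {..n} - descents p)"
    then obtain p i where x: "x = (p, i)" "p \<in> simsun n" "i \<le> n" "i \<notin> descents p" by auto
    note p = simsunD[OF x(2)]
    show "(case x of (p, i) \<Rightarrow> insert_at i (Suc n) p) \<in> simsun (Suc n)"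
      using x insert_at_in_simsun_iff[OF p(1) x(3)] by simp
    have "?p (insert_at i (Suc n) p) = p" using p by (auto simp: filter_insert_at filter_id_conv)
    moreover have "?i (insert_at i (Suc n) p) = i"
      by (rule length_takeWhile_insert_at) (use p x in auto)
    ultimately show "(?p (case x of (p, i) \<Rightarrow> insert_at i (Suc n) p),
        ?i (case x of (p, i) \<Rightarrow> insert_at i (Suc n) p)) = x" using x by simp
  qed
  also have "\<dots> = (\<Sum>p\<in>simsun n. \<Sum>i\<in>{..n} - descents p. f (insert_at i (Suc n) p))"
    by (subst sum.Sigma) (auto simp: finite_simsun)
  finally show ?thesis .
qed

lemma sum_insert_at_eq_grow:
  fixes F :: "nat \<Rightarrow> nat \<Rightarrow> 'a::semiring_1"
  assumes "p \<in> simsun n" "n \<ge> 1"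
  shows "(\<Sum>i\<in>{..n} - descents p. F (asc (insert_at i (Suc n) p)) (last (insert_at i (Suc n) p)))
    = grow n F (asc p) (last p)"
proof -
  note p = simsunD[OF assms(1)]
  let ?D = "descents p" and ?f = "\<lambda>i. F (asc (insert_at i (Suc n) p)) (last (insert_at i (Suc n) p))"
  \<comment> \<open>\<open>?S\<close> holds the slots between the two letters of a descent,
    \<open>?R\<close> the other admissible slots except the end.\<close>
  let ?S = "Suc ` ?D" and ?R = "{..<n} - ?D - Suc ` ?D"
  \<comment> \<open>Without double descents, no slot is both before a descent top and inside a
    descent, so these two kinds fill exactly \<open>2 * des p\<close> slots.\<close>
  have disj: "?D \<inter> ?S = {}"
    using simsun_no_double_descent[OF assms(1)] by (simp add: no_double_descent_iff_descents)
  have sub: "?D \<subseteq> {..<n - 1}" "?S \<subseteq> {..<n}" using p by (auto simp: descents_def)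
  have card_S: "card ?S = des p" by (simp add: card_image des_eq_card_descents)
  have "card ({..<n} - (?D \<union> ?S)) = n - card (?D \<union> ?S)"
    using sub assms(2) by (subst card_Diff_subset) auto
  moreover have "card (?D \<union> ?S) = 2 * des p"
    using disj card_S by (simp add: card_Un_disjoint des_eq_card_descents)
  ultimately have card_R: "card ?R = n - 2 * des p" by (simp add: Diff_Diff_Int Diff_eq Int_assoc)
  have des_le: "des p \<le> n - 1" using card_mono[OF _ sub(1)] by (simp add: des_eq_card_descents)
  have asc: "asc p = n - 1 - des p" using p by (simp add: asc_def)
  have Suc_asc: "n - des p = Suc (asc p)" using asc des_le assms(2) by simp
  have asc_ins: "asc (insert_at i (Suc n) p) = n - des (insert_at i (Suc n) p)" for i
    using p by (simp add: asc_def)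
  have des_ins: "des (insert_at i (Suc n) p) =
      (if i = n then des p else if i \<in> ?S then des p else Suc (des p))" if "i \<le> n" for i
    using des_insert_max[of i p "Suc n"] p that by auto
  have last_ins: "last (insert_at i (Suc n) p) = (if i = n then Suc n else last p)" if "i \<le> n" for i
    using last_insert_at[of i p "Suc n"] p that by auto
  have "n \<notin> ?D" "n \<notin> ?S" using sub assms(2) by auto
  then have indices: "{..n} - ?D = insert n (?S \<union> ?R)" using sub disj by auto
  have "(\<Sum>i\<in>{..n} - ?D. ?f i) = ?f n + (\<Sum>i\<in>?S \<union> ?R. ?f i)"
    unfolding indices by (rule sum.insert) (use \<open>n \<notin> ?S\<close> in auto)
  also have "(\<Sum>i\<in>?S \<union> ?R. ?f i) = (\<Sum>i\<in>?S. ?f i) + (\<Sum>i\<in>?R. ?f i)"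
    by (rule sum.union_disjoint) auto
  also have "?f n = F (Suc (asc p)) (Suc n)"
    using asc_ins[of n] des_ins[of n] last_ins[of n] Suc_asc by simp
  also have "(\<Sum>i\<in>?S. ?f i) = (\<Sum>i\<in>?S. F (Suc (asc p)) (last p))"
  proof (rule sum.cong)
    fix i assume i: "i \<in> ?S"
    then have "i < n" using sub by auto
    then show "?f i = F (Suc (asc p)) (last p)"
      using i des_ins[of i] asc_ins[of i] last_ins[of i] Suc_asc by simp
  qed simp
  also have "(\<Sum>i\<in>?R. ?f i) = (\<Sum>i\<in>?R. F (asc p) (last p))"
    by (rule sum.cong) (use des_ins asc_ins last_ins asc in auto)
  finally have "(\<Sum>i\<in>{..n} - ?D. ?f i) = F (Suc (asc p)) (Suc n)
      + (of_nat (des p) * F (Suc (asc p)) (last p) + of_nat (n - 2 * des p) * F (asc p) (last p))"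
    by (simp only: sum_constant card_S card_R)
  \<comment> \<open>Expresses the counts through \<open>asc\<close>, the form shared with inversion
    sequences.\<close>
  moreover have "n - 1 - asc p = des p" "2 * asc p + 2 - n = n - 2 * des p"
    using asc des_le assms(2) by auto
  ultimately show ?thesis by (simp add: grow_def add.assoc)
qed

lemma sum_simsun_Suc:
  fixes F :: "nat \<Rightarrow> nat \<Rightarrow> 'a::semiring_1"
  assumes "n \<ge> 1"
  shows "(\<Sum>q\<in>simsun (Suc n). F (asc q) (last q)) = (\<Sum>p\<in>simsun n. grow n F (asc p) (last p))"
  unfolding sum_simsun_Suc_eq_sum_insert_at
  by (intro sum.cong refl sum_insert_at_eq_grow assms)

section \<open>Inversion sequences avoiding 000\<close>

text \<open>Turns a multiplicity into a pattern: with three elements present, some element lies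
  strictly between \<open>Min S\<close> and \<open>Max S\<close>.\<close>

lemma three_le_card_iff:
  fixes S :: "'a::linorder set"
  assumes "finite S"
  shows "3 \<le> card S \<longleftrightarrow> (\<exists>i\<in>S. \<exists>j\<in>S. \<exists>k\<in>S. i < j \<and> j < k)"
proof
  assume c: "3 \<le> card S"
  then have ne: "S \<noteq> {}" by auto
  have "card {Min S, Max S} \<le> 2" by (simp add: card_insert_if)
  then have "\<not> S \<subseteq> {Min S, Max S}" using c card_mono[of "{Min S, Max S}" S] by auto
  then obtain j where j: "j \<in> S" "j \<noteq> Min S" "j \<noteq> Max S" by auto
  then have "Min S < j" "j < Max S" using assms by (auto simp: order.strict_iff_order)
  then show "\<exists>i\<in>S. \<exists>j\<in>S. \<exists>k\<in>S. i < j \<and> j < k" using j(1) assms ne Min_in Max_in by metis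
next
  assume "\<exists>i\<in>S. \<exists>j\<in>S. \<exists>k\<in>S. i < j \<and> j < k"
  then obtain i j k where "{i, j, k} \<subseteq> S" "i < j" "j < k" by auto
  moreover from this have "i \<noteq> j" "j \<noteq> k" "i \<noteq> k" by auto
  moreover from this have "card {i, j, k} = 3" by simp
  ultimately show "3 \<le> card S" using card_mono[OF assms] by metis
qed

text \<open>The positions carrying \<open>v\<close> number \<open>count_list e v\<close>, and three
  of them form the pattern. Multiplicities ignore order, so this form is convenient when entries
  move.\<close>

lemma inv_seqs_000_iff:
  "e \<in> inv_seqs_000 n \<longleftrightarrow> e \<in> inv_seqs n \<and> (\<forall>v. count_list e v \<le> 2)"
proof -
  have "(\<exists>i j k. i < j \<and> j < k \<and> k < n \<and> e ! i = e ! j \<and> e ! j = e ! k) \<longleftrightarrow>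
      (\<exists>v. \<not> count_list e v \<le> 2)" if "length e = n"
  proof -
    have "\<not> count_list e v \<le> 2 \<longleftrightarrow> (\<exists>i j k. i < j \<and> j < k \<and> k < n \<and> e ! i = v \<and> e ! j = v \<and> e ! k = v)" for v
    proof -
      have "count_list e v = card {i. i < n \<and> e ! i = v}"
        using that by (simp add: count_list_eq_length_filter length_filter_conv_card eq_commute)
      then have "\<not> count_list e v \<le> 2 \<longleftrightarrow> 3 \<le> card {i. i < n \<and> e ! i = v}" by linarith
      also have "\<dots> \<longleftrightarrow> (\<exists>i j k. i < j \<and> j < k \<and> k < n \<and> e ! i = v \<and> e ! j = v \<and> e ! k = v)"
        by (subst three_le_card_iff) (simp, fastforce)
      finally show ?thesis .
    qed
    then show ?thesis by metis
  qed
  then show ?thesis by (auto simp: inv_seqs_000_def inv_seqs_def)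
qed

section \<open>Inserting an entry into an inversion sequence\<close>

lemma snoc_in_inv_seqs_iff: "e @ [v] \<in> inv_seqs (Suc n) \<longleftrightarrow> e \<in> inv_seqs n \<and> v \<le> n"
  by (auto simp: inv_seqs_def All_less_Suc nth_append)

lemma inv_seqs_length: "e \<in> inv_seqs n \<Longrightarrow> length e = n"
  by (simp add: inv_seqs_def)

lemma inv_seqs_set: "e \<in> inv_seqs n \<Longrightarrow> set e \<subseteq> {..<n}"
  by (fastforce simp: inv_seqs_def in_set_conv_nth less_Suc_eq_le)

definition extend :: "nat list \<Rightarrow> nat \<Rightarrow> nat list" where
  "extend e w = (if w = length e then e @ [w] else butlast e @ [w, last e])"

text \<open>For an inversion sequence, \<open>length e - 1\<close> is the largest value the last
  entry may take; attaining it reveals which case of \<open>extend\<close> produced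
  \<open>e\<close>.\<close>

definition retract :: "nat list \<Rightarrow> nat list \<times> nat" where
  "retract e = (if last e = length e - 1 then (butlast e, last e)
     else (butlast (butlast e) @ [last e], last (butlast e)))"

text \<open>Only the multiplicity of \<open>w\<close> changes, rising by one. The old last entry is
  below \<open>n\<close>, so the extension ends in \<open>n\<close> only if \<open>w = n\<close>,
  and \<open>retract\<close> picks the right case.\<close>

lemma extend_in_inv_seqs_000:
  assumes "e \<in> inv_seqs_000 n" "w \<le> n" "count_list e w \<le> 1" "n \<ge> 1"
  shows "extend e w \<in> inv_seqs_000 (Suc n)" "retract (extend e w) = (e, w)"
proof -
  have e: "e \<in> inv_seqs n" "\<forall>v. count_list e v \<le> 2" "length e = n"
    using assms(1) by (auto simp: inv_seqs_000_iff inv_seqs_length)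
  then obtain xs v where xv: "e = xs @ [v]" using assms(4) by (cases e rule: rev_cases) auto
  obtain m where m: "n = Suc m" using assms(4) by (cases n) auto
  have xs: "xs \<in> inv_seqs m" "v \<le> m" "length xs = m"
    using e(1,3) by (simp_all add: xv m snoc_in_inv_seqs_iff)
  have "extend e w \<in> inv_seqs (Suc n)"
  proof (cases "w = n")
    case True
    then show ?thesis using e by (simp add: extend_def snoc_in_inv_seqs_iff)
  next
    case False
    \<comment> \<open>\<open>w \<noteq> n\<close> gives \<open>w \<le> m\<close>, the bound at index
      \<open>m\<close>; \<open>v\<close> moves right, where the bound is looser.\<close>
    have "(xs @ [w]) @ [v] \<in> inv_seqs (Suc n)"
      unfolding m snoc_in_inv_seqs_iff using xs False assms(2) m by simp
    then show ?thesis using False e(3) by (simp add: extend_def xv)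
  qed
  moreover have "count_list (extend e w) x = count_list e x + (if x = w then 1 else 0)" for x
    by (simp add: extend_def xv)
  ultimately show "extend e w \<in> inv_seqs_000 (Suc n)" using e(2) assms(3) by (simp add: inv_seqs_000_iff)
  show "retract (extend e w) = (e, w)"
    using xs by (simp add: extend_def retract_def xv m butlast_append)
qed

lemma retract_in_inv_seqs_000:
  assumes "e \<in> inv_seqs_000 (Suc n)" "retract e = (f, w)" "n \<ge> 1"
  shows "f \<in> inv_seqs_000 n" "w \<le> n" "count_list f w \<le> 1" "extend f w = e"
proof -
  have e: "e \<in> inv_seqs (Suc n)" "\<And>v. count_list e v \<le> 2" "length e = Suc n"
    using assms(1) by (auto simp: inv_seqs_000_iff inv_seqs_length)
  obtain m where m: "n = Suc m" using assms(3) by (cases n) auto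
  obtain ys v where yv: "e = ys @ [v]" using e(3) by (cases e rule: rev_cases) auto
  obtain xs y where xy: "ys = xs @ [y]" using e(3) yv m by (cases ys rule: rev_cases) auto
  have mem: "ys \<in> inv_seqs n" "xs \<in> inv_seqs m" "y \<le> m" "v \<le> n" "length xs = m"
    using e(1,3) unfolding yv xy m snoc_in_inv_seqs_iff by simp_all
  have "f \<in> inv_seqs_000 n \<and> w \<le> n \<and> count_list f w \<le> 1 \<and> extend f w = e"
  proof (cases "v = n")
    case True
    then have fw: "f = ys" "w = n" using assms(2) e(3) by (auto simp: retract_def yv)
    \<comment> \<open>All entries before the last are below \<open>n\<close>, so
      \<open>w = n\<close> does not occur in \<open>f\<close>.\<close>
    have "n \<notin> set ys" using inv_seqs_set[OF mem(1)] by auto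
    moreover have "count_list ys x \<le> 2" for x using e(2)[of x] by (simp add: yv split: if_splits)
    ultimately show ?thesis using mem fw True m by (simp add: inv_seqs_000_iff extend_def xy yv)
  next
    case False
    then have fw: "f = xs @ [v]" "w = y" using assms(2) mem by (auto simp: retract_def yv xy m butlast_append)
    \<comment> \<open>Removing one copy of \<open>y\<close> makes room: the instance
      \<open>x = y\<close> bounds \<open>count_list f w\<close> by one.\<close>
    have "count_list (xs @ [v]) x + (if x = y then 1 else 0) \<le> 2" for x
      using e(2)[of x] by (simp add: yv xy split: if_splits)
    from this this[of y] have "count_list f x \<le> 2" "count_list f w \<le> 1" for x
      unfolding fw by (metis add_leD1, simp split: if_splits)
    \<comment> \<open>\<open>v \<noteq> n\<close> leaves \<open>v \<le> m\<close>, so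
      \<open>v\<close> still fits one place further left.\<close>
    moreover have "f \<in> inv_seqs n" using mem False by (simp add: fw m snoc_in_inv_seqs_iff)
    ultimately show ?thesis using mem fw m by (simp add: inv_seqs_000_iff extend_def xy yv)
  qed
  then show "f \<in> inv_seqs_000 n" "w \<le> n" "count_list f w \<le> 1" "extend f w = e" by auto
qed

lemma sum_inv_seqs_000_Suc_eq_sum_extend:
  assumes "n \<ge> 1"
  shows "(\<Sum>e\<in>inv_seqs_000 (Suc n). f e) =
   (\<Sum>e\<in>inv_seqs_000 n. \<Sum>w | w \<le> n \<and> count_list e w \<le> 1. f (extend e w))"
proof -
  have "(\<Sum>e\<in>inv_seqs_000 (Suc n). f e) =
      (\<Sum>(e, w)\<in>(SIGMA e:inv_seqs_000 n. {w. w \<le> n \<and> count_list e w \<le> 1}). f (extend e w))"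
  proof (rule sum.reindex_bij_witness[where i = "\<lambda>(e, w). extend e w" and j = retract])
    fix e assume e: "e \<in> inv_seqs_000 (Suc n)"
    obtain g w where gw: "retract e = (g, w)" by fastforce
    note r = retract_in_inv_seqs_000[OF e gw assms]
    show "retract e \<in> (SIGMA e:inv_seqs_000 n. {w. w \<le> n \<and> count_list e w \<le> 1})"
      "(case retract e of (e, w) \<Rightarrow> extend e w) = e"
      "(case retract e of (e, w) \<Rightarrow> f (extend e w)) = f e"
      using r by (simp_all add: gw)
  next
    fix x assume "x \<in> (SIGMA e:inv_seqs_000 n. {w. w \<le> n \<and> count_list e w \<le> 1})"
    then obtain e w where x: "x = (e, w)" "e \<in> inv_seqs_000 n" "w \<le> n" "count_list e w \<le> 1" by auto
    show "(case x of (e, w) \<Rightarrow> extend e w) \<in> inv_seqs_000 (Suc n)"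
      "retract (case x of (e, w) \<Rightarrow> extend e w) = x"
      using extend_in_inv_seqs_000[OF x(2-4) assms] by (simp_all add: x(1))
  qed
  also have "\<dots> = (\<Sum>e\<in>inv_seqs_000 n. \<Sum>w | w \<le> n \<and> count_list e w \<le> 1. f (extend e w))"
    by (subst sum.Sigma) (auto simp: finite_inv_seqs_000)
  finally show ?thesis .
qed

lemma sum_extend_eq_grow:
  fixes F :: "nat \<Rightarrow> nat \<Rightarrow> 'a::semiring_1"
  assumes "e \<in> inv_seqs_000 n" "n \<ge> 1"
  shows "(\<Sum>w | w \<le> n \<and> count_list e w \<le> 1. F (dist_pos (extend e w)) (Suc (last (extend e w))))
    = grow n F (dist_pos e) (Suc (last e))"
proof -
  let ?f = "\<lambda>w. F (dist_pos (extend e w)) (Suc (last (extend e w)))"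
  let ?N = "{..<n} - set e" and ?O = "{w \<in> set e. count_list e w = 1}"
    and ?T = "{w \<in> set e. count_list e w = 2}"
  have e: "e \<in> inv_seqs n" "\<And>v. count_list e v \<le> 2" "length e = n"
    using assms by (auto simp: inv_seqs_000_iff inv_seqs_length)
  then have "e \<noteq> []" using assms(2) by auto
  have sub: "set e \<subseteq> {..<n}" by (rule inv_seqs_set[OF e(1)])
  have pos: "count_list e w > 0" if "w \<in> set e" for w
    using that by (metis count_list_0_iff gr0I)
  \<comment> \<open>The first entry is forced to be \<open>0\<close>, so there is one more distinct
    value than positive ones.\<close>
  have "e ! 0 < 0 + 1" using e(1) assms(2) unfolding inv_seqs_def by fastforce
  then have zero: "0 \<in> set e" using \<open>e \<noteq> []\<close> by (auto simp: in_set_conv_nth)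
  then have "set e = insert 0 {v \<in> set e. v > 0}" by auto
  then have card_e: "card (set e) = Suc (dist_pos e)"
    unfolding dist_pos_def by (metis (mono_tags, lifting) List.finite_set card_insert_disjoint
        finite_insert mem_Collect_eq finite_subset less_irrefl subset_insertI)
  have card_N: "card ?N = n - 1 - dist_pos e" using sub card_e by (simp add: card_Diff_subset)
  have set_e: "set e = ?O \<union> ?T"
  proof -
    have "count_list e w = 1 \<or> count_list e w = 2" if "w \<in> set e" for w
      using pos[OF that] e(2)[of w] by linarith
    then show ?thesis by auto
  qed
  \<comment> \<open>Counting entries with multiplicity and then without gives two equations;
    eliminating \<open>card ?T\<close> yields \<open>card ?O\<close>.\<close>
  have "n = (\<Sum>w\<in>set e. count_list e w)" using e(3) by (simp add: sum_count_set)
  also have "\<dots> = (\<Sum>w\<in>?O. count_list e w) + (\<Sum>w\<in>?T. count_list e w)"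
    by (subst set_e, rule sum.union_disjoint) auto
  also have "\<dots> = card ?O + 2 * card ?T" by simp
  finally have "n = card ?O + 2 * card ?T" .
  moreover have "card (set e) = card ?O + card ?T"
    by (subst set_e, rule card_Un_disjoint) auto
  ultimately have card_O: "card ?O = 2 * dist_pos e + 2 - n" using card_e by simp
  have set_ext: "set (extend e w) = insert w (set e)" for w
    using \<open>e \<noteq> []\<close> by (cases e rule: rev_cases) (auto simp: extend_def)
  have dist_ext: "dist_pos (extend e w) = (if w \<in> set e then dist_pos e else Suc (dist_pos e))" for w
  proof (cases "w \<in> set e")
    case True
    then show ?thesis by (simp add: dist_pos_def set_ext insert_absorb)
  next
    case False
    \<comment> \<open>A missing value is positive because \<open>0\<close> occurs, hence it raises
      \<open>dist_pos\<close>.\<close>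
    then have "{v \<in> insert w (set e). v > 0} = insert w {v \<in> set e. v > 0}"
      using zero by (auto intro: gr0I)
    then show ?thesis using False by (simp add: dist_pos_def set_ext)
  qed
  have last_ext: "last (extend e w) = (if w = n then n else last e)" for w
    using e(3) by (simp add: extend_def)
  have n: "n \<notin> set e" using sub by auto
  have "{w. w \<le> n \<and> count_list e w \<le> 1} = insert n (?N \<union> ?O)"
  proof (rule set_eqI)
    fix w
    have "w \<notin> set e \<Longrightarrow> count_list e w = 0" by simp
    then show "w \<in> {w. w \<le> n \<and> count_list e w \<le> 1} \<longleftrightarrow> w \<in> insert n (?N \<union> ?O)"
      using pos[of w] sub n by (cases "w \<in> set e") (auto simp: le_less)
  qed
  then have "(\<Sum>w | w \<le> n \<and> count_list e w \<le> 1. ?f w) = ?f n + (\<Sum>w\<in>?N \<union> ?O. ?f w)"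
    using n by simp
  also have "(\<Sum>w\<in>?N \<union> ?O. ?f w) = (\<Sum>w\<in>?N. ?f w) + (\<Sum>w\<in>?O. ?f w)"
    by (rule sum.union_disjoint) auto
  also have "?f n = F (Suc (dist_pos e)) (Suc n)" using n by (simp add: dist_ext last_ext)
  also have "(\<Sum>w\<in>?N. ?f w) = (\<Sum>w\<in>?N. F (Suc (dist_pos e)) (Suc (last e)))"
    by (rule sum.cong) (auto simp: dist_ext last_ext)
  also have "(\<Sum>w\<in>?O. ?f w) = (\<Sum>w\<in>?O. F (dist_pos e) (Suc (last e)))"
    by (rule sum.cong) (use n in \<open>auto simp: dist_ext last_ext\<close>)
  finally show ?thesis unfolding sum_constant card_N card_O grow_def by (simp only: add.assoc)
qed

lemma sum_inv_seqs_000_Suc: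
  fixes F :: "nat \<Rightarrow> nat \<Rightarrow> 'a::semiring_1"
  assumes "n \<ge> 1"
  shows "(\<Sum>e\<in>inv_seqs_000 (Suc n). F (dist_pos e) (Suc (last e))) =
    (\<Sum>e\<in>inv_seqs_000 n. grow n F (dist_pos e) (Suc (last e)))"
  unfolding sum_inv_seqs_000_Suc_eq_sum_extend[OF assms]
  by (intro sum.cong refl sum_extend_eq_grow assms)

section \<open>Equidistribution\<close>

lemma simsun_1: "simsun 1 = {[1]}"
  by (auto simp: simsun_def no_double_descent_def)

lemma inv_seqs_000_1: "inv_seqs_000 1 = {[0]}"
  by (auto simp: inv_seqs_000_def inv_seqs_def length_Suc_conv)

text \<open>The weight \<open>F\<close> stays arbitrary because the induction step applies the
  hypothesis to \<open>grow n F\<close>.\<close>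

lemma sum_simsun_eq_sum_inv_seqs_000:
  fixes F :: "nat \<Rightarrow> nat \<Rightarrow> 'a::semiring_1"
  assumes "n \<ge> 1"
  shows "(\<Sum>p\<in>simsun n. F (asc p) (last p)) = (\<Sum>e\<in>inv_seqs_000 n. F (dist_pos e) (Suc (last e)))"
  using assms
proof (induction n arbitrary: F rule: nat_induct_at_least)
  case base
  have "asc [1] = 0" "dist_pos [0] = 0" by (auto simp: asc_def dist_pos_def)
  then show ?case unfolding simsun_1 inv_seqs_000_1 by simp
next
  case (Suc n)
  then show ?case by (simp add: sum_simsun_Suc sum_inv_seqs_000_Suc)
qed

theorem theorem5p1:
  fixes n :: nat and t u :: "'a :: comm_semiring_1"
  assumes "n \<ge> 1"
  shows "(\<Sum>p\<in>simsun n. t ^ asc p * u ^ last p) =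
         (\<Sum>e\<in>inv_seqs_000 n. t ^ dist_pos e * u ^ (last e + 1))"
  using sum_simsun_eq_sum_inv_seqs_000[OF assms, of "\<lambda>a l. t ^ a * u ^ l"] by simp

end
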